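(* Let $(\Pi,A,\xi)$ and $(\Pi',A',\xi')$ be Gr-categories of type $(\Pi,A)$ and $(\Pi',A')$ respectively, and let $F:(\Pi,A,\xi)\to(\Pi',A',\xi')$ be a functor of the type $(\varphi,f)$. Regard $A'$ as a $\Pi$-module via $xa'=\varphi(x)a'$. Then $F$ is a Gr-functor (that is, $F$ admits a monoidal structure $(\widetilde F,\hat F)$) if and only if its obstruction $k=\varphi^*\xi'-f_*\xi$ has class $\overline{k}=0$ in $H^3(\Pi,A')$.
   Context: A Gr-category is a monoidal category $(\mathcal C,\otimes,I,a,l,r)$ in which every object is invertible (for $\otimes$, up to isomorphism) and every arrow is an isomorphism; the associativity constraint is directed as $a_{X,Y,Z}:X\otimes(Y\otimes Z)\to(X\otimes Y)\otimes Z$. A Gr-functor is a monoidal functor $(F,\widetilde F,\hat F)$ between Gr-categories, with natural isomorphisms $\widetilde F_{X,Y}:FX\otimes FY\to F(X\otimes Y)$ and an isomorphism $\hat F:I'\to FI$ satisfying the usual coherence conditions with the associativity and unit constraints. Given a group $\Pi$, a (left) $\Pi$-module $A$ (written additively) and a normalized 3-cocycle $\xi:\Pi^3\to A$, the Gr-category $(\Pi,A,\xi)$ (of type $(\Pi,A)$) has as objects the elements of $\Pi$ and as arrows the automorphisms $(x,u):x\to x$ with $x\in\Pi$, $u\in A$ (no arrows between distinct objects); composition is $(x,u).(x,v)=(x,u+v)$; the tensor product is $x\otimes y=xy$, $(x,u)\otimes(y,v)=(xy,u+xv)$; the unit constraints are identities (with unit object $1$); and the associativity constraint is $a_{x,y,z}=(xyz,\xi(x,y,z))$.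 A functor $F:(\Pi,A,\xi)\to(\Pi',A',\xi')$ is of the type $(\varphi,f)$ if $F(x)=\varphi(x)$ and $F(x,u)=(\varphi(x),f(u))$, where $\varphi:\Pi\to\Pi'$ and $f:A\to A'$ are group homomorphisms with $f(xa)=\varphi(x)f(a)$ for all $x\in\Pi$, $a\in A$. For such $F$, set $(f_*\xi)(x,y,z)=f(\xi(x,y,z))$ and $(\varphi^*\xi')(x,y,z)=\xi'(\varphi x,\varphi y,\varphi z)$; both are 3-cocycles of $\Pi$ with coefficients in $A'$ (with the $\Pi$-action via $\varphi$). The function $k=\varphi^*\xi'-f_*\xi$ is called the obstruction of $F$. *)

theory Defs
  imports "HOL-Algebra.AbelCoset"
begin

section \<open>Categories, monoidal categories and Gr-categories\<close>

text \<open>\<open>g \<cdot> f\<close> is the composite ``\<open>f\<close> first, then \<open>g\<close>''. Outside \<open>Obj\<close>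
  and \<open>Arr\<close> the operations are unconstrained.\<close>

record ('o, 'm) cat =
  Obj :: "'o set"
  Arr :: "'m set"
  Dom :: "'m \<Rightarrow> 'o"
  Cod :: "'m \<Rightarrow> 'o"
  Id :: "'o \<Rightarrow> 'm"
  Comp :: "'m \<Rightarrow> 'm \<Rightarrow> 'm"  (infixl "\<cdot>\<index>" 65)

definition Hom :: "('o, 'm, 'z) cat_scheme \<Rightarrow> 'o \<Rightarrow> 'o \<Rightarrow> 'm set" where
  "Hom C X Y = {f \<in> Arr C. Dom C f = X \<and> Cod C f = Y}"

locale category =
  fixes C :: "('o, 'm, 'z) cat_scheme" (structure)
  assumes Dom_closed: "f \<in> Arr C \<Longrightarrow> Dom C f \<in> Obj C"
    and Cod_closed: "f \<in> Arr C \<Longrightarrow> Cod C f \<in> Obj C"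
    and Id_closed: "X \<in> Obj C \<Longrightarrow> Id C X \<in> Hom C X X"
    and Comp_closed:
      "\<lbrakk>f \<in> Hom C X Y; g \<in> Hom C Y Z\<rbrakk> \<Longrightarrow> g \<cdot> f \<in> Hom C X Z"
    and Comp_assoc:
      "\<lbrakk>f \<in> Hom C W X; g \<in> Hom C X Y; h \<in> Hom C Y Z\<rbrakk>
        \<Longrightarrow> h \<cdot> (g \<cdot> f) = (h \<cdot> g) \<cdot> f"
    and Comp_Id_left: "f \<in> Hom C X Y \<Longrightarrow> Id C Y \<cdot> f = f"
    and Comp_Id_right: "f \<in> Hom C X Y \<Longrightarrow> f \<cdot> Id C X = f"

definition iso_arrows :: "('o, 'm, 'z) cat_scheme \<Rightarrow> 'o \<Rightarrow> 'o \<Rightarrow> 'm set" where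
  "iso_arrows C X Y =
    {f \<in> Hom C X Y. \<exists>g \<in> Hom C Y X. g \<cdot>\<^bsub>C\<^esub> f = Id C X \<and> f \<cdot>\<^bsub>C\<^esub> g = Id C Y}"

record ('o, 'm, 'p, 'n) cat_map =
  obj_map :: "'o \<Rightarrow> 'p"
  arr_map :: "'m \<Rightarrow> 'n"

locale cat_functor = C: category C + D: category D
  for C :: "('o, 'm, 'y) cat_scheme" (structure)
  and D :: "('p, 'n, 'z) cat_scheme" (structure) +
  fixes F :: "('o, 'm, 'p, 'n) cat_map"
  assumes obj_map_closed: "X \<in> Obj C \<Longrightarrow> obj_map F X \<in> Obj D"
    and arr_map_closed:
      "f \<in> Hom C X Y \<Longrightarrow> arr_map F f \<in> Hom D (obj_map F X) (obj_map F Y)"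
    and arr_map_Id: "X \<in> Obj C \<Longrightarrow> arr_map F (Id C X) = Id D (obj_map F X)"
    and arr_map_Comp:
      "\<lbrakk>f \<in> Hom C X Y; g \<in> Hom C Y Z\<rbrakk>
        \<Longrightarrow> arr_map F (g \<cdot>\<^bsub>C\<^esub> f) = arr_map F g \<cdot>\<^bsub>D\<^esub> arr_map F f"

text \<open>The tensor product is written \<open>\<boxdot>\<close> on objects and \<open>\<boxtimes>\<close> on arrows.\<close>

record ('o, 'm) mon_cat = "('o, 'm) cat" +
  TensorObj :: "'o \<Rightarrow> 'o \<Rightarrow> 'o"  (infixl "\<boxdot>\<index>" 70)
  TensorArr :: "'m \<Rightarrow> 'm \<Rightarrow> 'm"  (infixl "\<boxtimes>\<index>" 70)
  Unit :: "'o"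
  Assoc :: "'o \<Rightarrow> 'o \<Rightarrow> 'o \<Rightarrow> 'm"
  LUnit :: "'o \<Rightarrow> 'm"
  RUnit :: "'o \<Rightarrow> 'm"

text \<open>The associativity constraint is directed as
  \<open>X \<boxdot> (Y \<boxdot> Z) \<rightarrow> (X \<boxdot> Y) \<boxdot> Z\<close>.\<close>

locale monoidal_category = category C
  for C :: "('o, 'm, 'z) mon_cat_scheme" (structure) +
  assumes TensorObj_closed: "\<lbrakk>X \<in> Obj C; Y \<in> Obj C\<rbrakk> \<Longrightarrow> X \<boxdot> Y \<in> Obj C"
    and TensorArr_closed:
      "\<lbrakk>f \<in> Hom C X X'; g \<in> Hom C Y Y'\<rbrakk> \<Longrightarrow> f \<boxtimes> g \<in> Hom C (X \<boxdot> Y) (X' \<boxdot> Y')"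
    and TensorArr_Id:
      "\<lbrakk>X \<in> Obj C; Y \<in> Obj C\<rbrakk> \<Longrightarrow> Id C X \<boxtimes> Id C Y = Id C (X \<boxdot> Y)"
    and TensorArr_Comp:
      "\<lbrakk>f \<in> Hom C X X'; f' \<in> Hom C X' X''; g \<in> Hom C Y Y'; g' \<in> Hom C Y' Y''\<rbrakk>
        \<Longrightarrow> (f' \<cdot> f) \<boxtimes> (g' \<cdot> g) = (f' \<boxtimes> g') \<cdot> (f \<boxtimes> g)"
    and Unit_closed: "Unit C \<in> Obj C"
    and Assoc_iso:
      "\<lbrakk>X \<in> Obj C; Y \<in> Obj C; Z \<in> Obj C\<rbrakk>
        \<Longrightarrow> Assoc C X Y Z \<in> iso_arrows C (X \<boxdot> (Y \<boxdot> Z)) ((X \<boxdot> Y) \<boxdot> Z)"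
    and LUnit_iso: "X \<in> Obj C \<Longrightarrow> LUnit C X \<in> iso_arrows C (Unit C \<boxdot> X) X"
    and RUnit_iso: "X \<in> Obj C \<Longrightarrow> RUnit C X \<in> iso_arrows C (X \<boxdot> Unit C) X"
    and Assoc_natural:
      "\<lbrakk>f \<in> Hom C X X'; g \<in> Hom C Y Y'; h \<in> Hom C Z Z'\<rbrakk>
        \<Longrightarrow> Assoc C X' Y' Z' \<cdot> (f \<boxtimes> (g \<boxtimes> h)) = ((f \<boxtimes> g) \<boxtimes> h) \<cdot> Assoc C X Y Z"
    and LUnit_natural:
      "f \<in> Hom C X X' \<Longrightarrow> LUnit C X' \<cdot> (Id C (Unit C) \<boxtimes> f) = f \<cdot> LUnit C X"
    and RUnit_natural:
      "f \<in> Hom C X X' \<Longrightarrow> RUnit C X' \<cdot> (f \<boxtimes> Id C (Unit C)) = f \<cdot> RUnit C X"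
    and pentagon:
      "\<lbrakk>X \<in> Obj C; Y \<in> Obj C; Z \<in> Obj C; T \<in> Obj C\<rbrakk>
        \<Longrightarrow> Assoc C (X \<boxdot> Y) Z T \<cdot> Assoc C X Y (Z \<boxdot> T)
          = (Assoc C X Y Z \<boxtimes> Id C T)
            \<cdot> (Assoc C X (Y \<boxdot> Z) T \<cdot> (Id C X \<boxtimes> Assoc C Y Z T))"
    and triangle:
      "\<lbrakk>X \<in> Obj C; Y \<in> Obj C\<rbrakk>
        \<Longrightarrow> (RUnit C X \<boxtimes> Id C Y) \<cdot> Assoc C X (Unit C) Y = Id C X \<boxtimes> LUnit C Y"

locale gr_category = monoidal_category C
  for C :: "('o, 'm, 'z) mon_cat_scheme" (structure) +
  assumes object_invertible:
      "X \<in> Obj C \<Longrightarrow> \<exists>Y \<in> Obj C. iso_arrows C (X \<boxdot> Y) (Unit C) \<noteq> {}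
                             \<and> iso_arrows C (Y \<boxdot> X) (Unit C) \<noteq> {}"
    and arrow_iso: "f \<in> Hom C X Y \<Longrightarrow> f \<in> iso_arrows C X Y"

text \<open>\<open>Ft X Y : F X \<boxdot> F Y \<rightarrow> F (X \<boxdot> Y)\<close> and \<open>Fh : I' \<rightarrow> F I\<close>.\<close>

locale monoidal_functor =
  C: monoidal_category C + D: monoidal_category D + cat_functor C D F
  for C :: "('o, 'm, 'y) mon_cat_scheme" (structure)
  and D :: "('p, 'n, 'z) mon_cat_scheme" (structure)
  and F :: "('o, 'm, 'p, 'n) cat_map" +
  fixes Ft :: "'o \<Rightarrow> 'o \<Rightarrow> 'n" and Fh :: "'n"
  assumes Ft_iso:
      "\<lbrakk>X \<in> Obj C; Y \<in> Obj C\<rbrakk>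
        \<Longrightarrow> Ft X Y \<in> iso_arrows D (obj_map F X \<boxdot>\<^bsub>D\<^esub> obj_map F Y) (obj_map F (X \<boxdot>\<^bsub>C\<^esub> Y))"
    and Ft_natural:
      "\<lbrakk>u \<in> Hom C X X'; v \<in> Hom C Y Y'\<rbrakk>
        \<Longrightarrow> Ft X' Y' \<cdot>\<^bsub>D\<^esub> (arr_map F u \<boxtimes>\<^bsub>D\<^esub> arr_map F v)
          = arr_map F (u \<boxtimes>\<^bsub>C\<^esub> v) \<cdot>\<^bsub>D\<^esub> Ft X Y"
    and Fh_iso: "Fh \<in> iso_arrows D (Unit D) (obj_map F (Unit C))"
    and assoc_coherence:
      "\<lbrakk>X \<in> Obj C; Y \<in> Obj C; Z \<in> Obj C\<rbrakk>
        \<Longrightarrow> arr_map F (Assoc C X Y Z)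
              \<cdot>\<^bsub>D\<^esub> (Ft X (Y \<boxdot>\<^bsub>C\<^esub> Z) \<cdot>\<^bsub>D\<^esub> (Id D (obj_map F X) \<boxtimes>\<^bsub>D\<^esub> Ft Y Z))
          = Ft (X \<boxdot>\<^bsub>C\<^esub> Y) Z
              \<cdot>\<^bsub>D\<^esub> ((Ft X Y \<boxtimes>\<^bsub>D\<^esub> Id D (obj_map F Z))
              \<cdot>\<^bsub>D\<^esub> Assoc D (obj_map F X) (obj_map F Y) (obj_map F Z))"
    and left_unit_coherence:
      "X \<in> Obj C
        \<Longrightarrow> arr_map F (LUnit C X)
              \<cdot>\<^bsub>D\<^esub> (Ft (Unit C) X \<cdot>\<^bsub>D\<^esub> (Fh \<boxtimes>\<^bsub>D\<^esub> Id D (obj_map F X)))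
          = LUnit D (obj_map F X)"
    and right_unit_coherence:
      "X \<in> Obj C
        \<Longrightarrow> arr_map F (RUnit C X)
              \<cdot>\<^bsub>D\<^esub> (Ft X (Unit C) \<cdot>\<^bsub>D\<^esub> (Id D (obj_map F X) \<boxtimes>\<^bsub>D\<^esub> Fh))
          = RUnit D (obj_map F X)"

definition gr_functor ::
  "('o, 'm, 'y) mon_cat_scheme \<Rightarrow> ('p, 'n, 'z) mon_cat_scheme
    \<Rightarrow> ('o, 'm, 'p, 'n) cat_map \<Rightarrow> bool" where
  "gr_functor C D F \<longleftrightarrow>
    gr_category C \<and> gr_category D \<and> (\<exists>Ft Fh. monoidal_functor C D F Ft Fh)"


section \<open>Modules over a group and the third cohomology group\<close>

text \<open>Of the ring record \<open>A\<close> only the additive group is used.\<close>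

locale group_module = G: group G + A: abelian_group A
  for G :: "('g, 'k) monoid_scheme" (structure)
  and A :: "('a, 'l) ring_scheme" (structure) +
  fixes act :: "'g \<Rightarrow> 'a \<Rightarrow> 'a"
  assumes act_closed: "\<lbrakk>x \<in> carrier G; a \<in> carrier A\<rbrakk> \<Longrightarrow> act x a \<in> carrier A"
    and act_add:
      "\<lbrakk>x \<in> carrier G; a \<in> carrier A; b \<in> carrier A\<rbrakk>
        \<Longrightarrow> act x (a \<oplus>\<^bsub>A\<^esub> b) = act x a \<oplus>\<^bsub>A\<^esub> act x b"
    and act_one: "a \<in> carrier A \<Longrightarrow> act \<one>\<^bsub>G\<^esub> a = a"
    and act_mult:
      "\<lbrakk>x \<in> carrier G; y \<in> carrier G; a \<in> carrier A\<rbrakk>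
        \<Longrightarrow> act (x \<otimes>\<^bsub>G\<^esub> y) a = act x (act y a)"

text \<open>Cochains are not required to be normalized. To make equality of cochains
  agree with equality of functions, they are taken extensional, i.e. equal to
  \<open>undefined\<close> outside the carrier.\<close>

definition cochains :: "'x set \<Rightarrow> ('a, 'l) ring_scheme \<Rightarrow> ('x \<Rightarrow> 'a) monoid" where
  "cochains S A =
    \<lparr>carrier = S \<rightarrow>\<^sub>E carrier A,
     mult = (\<lambda>c d. \<lambda>s\<in>S. c s \<oplus>\<^bsub>A\<^esub> d s),
     one = (\<lambda>s\<in>S. \<zero>\<^bsub>A\<^esub>)\<rparr>"

abbreviation cochains2 ::
  "('g, 'k) monoid_scheme \<Rightarrow> ('a, 'l) ring_scheme \<Rightarrow> ('g \<times> 'g \<Rightarrow> 'a) monoid" where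
  "cochains2 G A \<equiv> cochains (carrier G \<times> carrier G) A"

abbreviation cochains3 ::
  "('g, 'k) monoid_scheme \<Rightarrow> ('a, 'l) ring_scheme \<Rightarrow> ('g \<times> 'g \<times> 'g \<Rightarrow> 'a) monoid" where
  "cochains3 G A \<equiv> cochains (carrier G \<times> carrier G \<times> carrier G) A"

abbreviation cochains4 ::
  "('g, 'k) monoid_scheme \<Rightarrow> ('a, 'l) ring_scheme
    \<Rightarrow> ('g \<times> 'g \<times> 'g \<times> 'g \<Rightarrow> 'a) monoid" where
  "cochains4 G A \<equiv> cochains (carrier G \<times> carrier G \<times> carrier G \<times> carrier G) A"

definition coboundary2 ::
  "('g, 'k) monoid_scheme \<Rightarrow> ('a, 'l) ring_scheme \<Rightarrow> ('g \<Rightarrow> 'a \<Rightarrow> 'a)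
    \<Rightarrow> ('g \<times> 'g \<Rightarrow> 'a) \<Rightarrow> 'g \<times> 'g \<times> 'g \<Rightarrow> 'a" where
  "coboundary2 G A act c =
    (\<lambda>(x, y, z) \<in> carrier G \<times> carrier G \<times> carrier G.
      act x (c (y, z)) \<ominus>\<^bsub>A\<^esub> c (x \<otimes>\<^bsub>G\<^esub> y, z) \<oplus>\<^bsub>A\<^esub> c (x, y \<otimes>\<^bsub>G\<^esub> z) \<ominus>\<^bsub>A\<^esub> c (x, y))"

definition coboundary3 ::
  "('g, 'k) monoid_scheme \<Rightarrow> ('a, 'l) ring_scheme \<Rightarrow> ('g \<Rightarrow> 'a \<Rightarrow> 'a)
    \<Rightarrow> ('g \<times> 'g \<times> 'g \<Rightarrow> 'a) \<Rightarrow> 'g \<times> 'g \<times> 'g \<times> 'g \<Rightarrow> 'a" where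
  "coboundary3 G A act c =
    (\<lambda>(x, y, z, t) \<in> carrier G \<times> carrier G \<times> carrier G \<times> carrier G.
      act x (c (y, z, t)) \<ominus>\<^bsub>A\<^esub> c (x \<otimes>\<^bsub>G\<^esub> y, z, t) \<oplus>\<^bsub>A\<^esub> c (x, y \<otimes>\<^bsub>G\<^esub> z, t)
        \<ominus>\<^bsub>A\<^esub> c (x, y, z \<otimes>\<^bsub>G\<^esub> t) \<oplus>\<^bsub>A\<^esub> c (x, y, z))"

definition Z3 ::
  "('g, 'k) monoid_scheme \<Rightarrow> ('a, 'l) ring_scheme \<Rightarrow> ('g \<Rightarrow> 'a \<Rightarrow> 'a)
    \<Rightarrow> ('g \<times> 'g \<times> 'g \<Rightarrow> 'a) monoid" where
  "Z3 G A act =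
    (cochains3 G A)\<lparr>carrier := kernel (cochains3 G A) (cochains4 G A) (coboundary3 G A act)\<rparr>"

definition B3 ::
  "('g, 'k) monoid_scheme \<Rightarrow> ('a, 'l) ring_scheme \<Rightarrow> ('g \<Rightarrow> 'a \<Rightarrow> 'a)
    \<Rightarrow> ('g \<times> 'g \<times> 'g \<Rightarrow> 'a) set" where
  "B3 G A act = coboundary2 G A act ` carrier (cochains2 G A)"

definition H3 ::
  "('g, 'k) monoid_scheme \<Rightarrow> ('a, 'l) ring_scheme \<Rightarrow> ('g \<Rightarrow> 'a \<Rightarrow> 'a)
    \<Rightarrow> ('g \<times> 'g \<times> 'g \<Rightarrow> 'a) set monoid" where
  "H3 G A act = Z3 G A act Mod B3 G A act"

definition H3_class ::
  "('g, 'k) monoid_scheme \<Rightarrow> ('a, 'l) ring_scheme \<Rightarrow> ('g \<Rightarrow> 'a \<Rightarrow> 'a)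
    \<Rightarrow> ('g \<times> 'g \<times> 'g \<Rightarrow> 'a) \<Rightarrow> ('g \<times> 'g \<times> 'g \<Rightarrow> 'a) set" where
  "H3_class G A act k = B3 G A act #>\<^bsub>Z3 G A act\<^esub> k"

definition normalized3 ::
  "('g, 'k) monoid_scheme \<Rightarrow> ('a, 'l) ring_scheme \<Rightarrow> ('g \<times> 'g \<times> 'g \<Rightarrow> 'a) \<Rightarrow> bool" where
  "normalized3 G A \<xi> \<longleftrightarrow>
    (\<forall>x \<in> carrier G. \<forall>y \<in> carrier G.
      \<xi> (\<one>\<^bsub>G\<^esub>, x, y) = \<zero>\<^bsub>A\<^esub> \<and> \<xi> (x, \<one>\<^bsub>G\<^esub>, y) = \<zero>\<^bsub>A\<^esub> \<and> \<xi> (x, y, \<one>\<^bsub>G\<^esub>) = \<zero>\<^bsub>A\<^esub>)"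


section \<open>The Gr-category of a normalized 3-cocycle\<close>

definition cocycle_cat ::
  "('g, 'k) monoid_scheme \<Rightarrow> ('a, 'l) ring_scheme \<Rightarrow> ('g \<Rightarrow> 'a \<Rightarrow> 'a)
    \<Rightarrow> ('g \<times> 'g \<times> 'g \<Rightarrow> 'a) \<Rightarrow> ('g, 'g \<times> 'a) mon_cat" where
  "cocycle_cat G A act \<xi> =
    \<lparr>Obj = carrier G,
     Arr = carrier G \<times> carrier A,
     Dom = fst,
     Cod = fst,
     Id = (\<lambda>x. (x, \<zero>\<^bsub>A\<^esub>)),
     Comp = (\<lambda>(x, u) (y, v). (x, u \<oplus>\<^bsub>A\<^esub> v)),
     TensorObj = (\<lambda>x y. x \<otimes>\<^bsub>G\<^esub> y),
     TensorArr = (\<lambda>(x, u) (y, v). (x \<otimes>\<^bsub>G\<^esub> y, u \<oplus>\<^bsub>A\<^esub> act x v)),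
     Unit = \<one>\<^bsub>G\<^esub>,
     Assoc = (\<lambda>x y z. (x \<otimes>\<^bsub>G\<^esub> y \<otimes>\<^bsub>G\<^esub> z, \<xi> (x, y, z))),
     LUnit = (\<lambda>x. (x, \<zero>\<^bsub>A\<^esub>)),
     RUnit = (\<lambda>x. (x, \<zero>\<^bsub>A\<^esub>))\<rparr>"

definition functor_of_type ::
  "('g, 'k) monoid_scheme \<Rightarrow> ('a, 'l) ring_scheme \<Rightarrow> ('g \<Rightarrow> 'a \<Rightarrow> 'a)
    \<Rightarrow> ('g \<times> 'g \<times> 'g \<Rightarrow> 'a)
    \<Rightarrow> ('h, 'i) monoid_scheme \<Rightarrow> ('b, 'j) ring_scheme \<Rightarrow> ('h \<Rightarrow> 'b \<Rightarrow> 'b)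
    \<Rightarrow> ('h \<times> 'h \<times> 'h \<Rightarrow> 'b)
    \<Rightarrow> ('g \<Rightarrow> 'h) \<Rightarrow> ('a \<Rightarrow> 'b) \<Rightarrow> ('g, 'g \<times> 'a, 'h, 'h \<times> 'b) cat_map \<Rightarrow> bool" where
  "functor_of_type G A act \<xi> G' A' act' \<xi>' \<phi> f F \<longleftrightarrow>
    cat_functor (cocycle_cat G A act \<xi>) (cocycle_cat G' A' act' \<xi>') F \<and>
    \<phi> \<in> hom G G' \<and>
    f \<in> hom (add_monoid A) (add_monoid A') \<and>
    (\<forall>x \<in> carrier G. \<forall>a \<in> carrier A. f (act x a) = act' (\<phi> x) (f a)) \<and>
    (\<forall>x \<in> carrier G. obj_map F x = \<phi> x) \<and>
    (\<forall>x \<in> carrier G. \<forall>u \<in> carrier A. arr_map F (x, u) = (\<phi> x, f u))"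

definition push_cochain ::
  "('g, 'k) monoid_scheme \<Rightarrow> ('a \<Rightarrow> 'b) \<Rightarrow> ('g \<times> 'g \<times> 'g \<Rightarrow> 'a)
    \<Rightarrow> 'g \<times> 'g \<times> 'g \<Rightarrow> 'b" where
  "push_cochain G f \<xi> =
    (\<lambda>(x, y, z) \<in> carrier G \<times> carrier G \<times> carrier G. f (\<xi> (x, y, z)))"

definition pull_cochain ::
  "('g, 'k) monoid_scheme \<Rightarrow> ('g \<Rightarrow> 'h) \<Rightarrow> ('h \<times> 'h \<times> 'h \<Rightarrow> 'b)
    \<Rightarrow> 'g \<times> 'g \<times> 'g \<Rightarrow> 'b" where
  "pull_cochain G \<phi> \<xi>' =
    (\<lambda>(x, y, z) \<in> carrier G \<times> carrier G \<times> carrier G. \<xi>' (\<phi> x, \<phi> y, \<phi> z))"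

definition obstruction ::
  "('g, 'k) monoid_scheme \<Rightarrow> ('b, 'j) ring_scheme \<Rightarrow> ('g \<Rightarrow> 'h) \<Rightarrow> ('a \<Rightarrow> 'b)
    \<Rightarrow> ('g \<times> 'g \<times> 'g \<Rightarrow> 'a) \<Rightarrow> ('h \<times> 'h \<times> 'h \<Rightarrow> 'b) \<Rightarrow> 'g \<times> 'g \<times> 'g \<Rightarrow> 'b" where
  "obstruction G A' \<phi> f \<xi> \<xi>' =
    (\<lambda>s \<in> carrier G \<times> carrier G \<times> carrier G.
      pull_cochain G \<phi> \<xi>' s \<ominus>\<^bsub>A'\<^esub> push_cochain G f \<xi> s)"

end

theory Submission
  imports Defs
begin

text \<open>
  In the Gr-category of a cocycle every arrow is a pair of an object and an element of the
  coefficient module, so each diagram of arrows is one equation in that module. In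
  particular the pentagon axiom is the 3-cocycle identity.

  Let \<open>F\<close> be a functor of type \<open>(\<phi>, f)\<close>. A family of arrows
  \<open>F x \<boxdot> F y \<rightarrow> F (x \<boxdot> y)\<close> is then the same thing as a 2-cochain \<open>c\<close> of \<open>G\<close> with values
  in \<open>A'\<close>, and it is automatically natural because \<open>f\<close> is equivariant and
  \<open>A'\<close> is commutative. Writing out the associativity coherence gives
  \<open>f(\<xi>(x,y,z)) + (c(x,yz) + x c(y,z)) = c(xy,z) + (c(x,y) + \<xi>'(\<phi> x,\<phi> y,\<phi> z))\<close>,
  that is, the obstruction is the coboundary of \<open>c\<close>. A monoidal structure therefore exhibits the
  obstruction as a coboundary.

  Conversely, let the obstruction be the coboundary of \<open>c\<close>. The only further requirement is an
  arrow \<open>I' \<rightarrow> F I\<close>, that is, an element \<open>h\<close> of \<open>A'\<close>, with \<open>c(1,x) + h = 0\<close> and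
  \<open>c(x,1) + x h = 0\<close> for all \<open>x\<close>. The cochain \<open>c\<close> is in general not normalized, but \<open>\<xi>\<close> and
  \<open>\<xi>'\<close> are, and evaluating the coherence equation at \<open>(1,1,x)\<close> and \<open>(x,1,1)\<close> yields
  \<open>c(1,x) = c(1,1)\<close> and \<open>c(x,1) = x c(1,1)\<close>; so \<open>h = - c(1,1)\<close> works.

  Both directions are in \<open>monoidal_structure_iff_obstruction_coboundary\<close>. What remains is that
  both categories are Gr-categories (\<open>gr_category_cocycle_cat\<close>), and that a class in
  the third cohomology group is trivial exactly when its representative is a coboundary
  (\<open>H3_class_eq_one_iff\<close>).
\<close>

section \<open>Additive identities in an abelian group\<close>

context abelian_group
begin

lemma minus_eq_zero_iff:
  assumes "a \<in> carrier G" "b \<in> carrier G"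
  shows "a \<ominus> b = \<zero> \<longleftrightarrow> a = b"
proof
  assume "a \<ominus> b = \<zero>"
  then have "a \<ominus> b \<oplus> b = b" using assms by simp
  then show "a = b" using assms by (simp add: a_minus_def a_assoc l_neg)
qed (use assms in \<open>simp add: a_minus_def r_neg\<close>)

text \<open>The left-hand equation is the associativity coherence of a monoidal functor, in the order
  in which the composites produce it; the right-hand one says that an obstruction equals a
  coboundary.\<close>

lemma four_term_eq_iff:
  assumes "a \<in> carrier G" "b \<in> carrier G" "p \<in> carrier G" "q \<in> carrier G"
    and "r \<in> carrier G" "s \<in> carrier G"
  shows "a \<oplus> (r \<oplus> p) = q \<oplus> (s \<oplus> b) \<longleftrightarrow> b \<ominus> a = p \<ominus> q \<oplus> r \<ominus> s"
proof -
  have "a \<oplus> (r \<oplus> p) \<ominus> (q \<oplus> (s \<oplus> b)) = p \<ominus> q \<oplus> r \<ominus> s \<ominus> (b \<ominus> a)"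
    using assms by (simp add: a_minus_def minus_add a_ac)
  with assms show ?thesis
    using minus_eq_zero_iff[of "a \<oplus> (r \<oplus> p)" "q \<oplus> (s \<oplus> b)"]
      minus_eq_zero_iff[of "p \<ominus> q \<oplus> r \<ominus> s" "b \<ominus> a"]
    by auto
qed

text \<open>The left-hand equation is the 3-cocycle condition, the right-hand one the pentagon axiom
  with its terms in the order of composition.\<close>

lemma alternating_sum_zero_iff:
  assumes "p \<in> carrier G" "q \<in> carrier G" "r \<in> carrier G" "s \<in> carrier G" "t \<in> carrier G"
  shows "p \<ominus> q \<oplus> r \<ominus> s \<oplus> t = \<zero> \<longleftrightarrow> q \<oplus> s = t \<oplus> (r \<oplus> p)"
proof -
  have "p \<ominus> q \<oplus> r \<ominus> s \<oplus> t = t \<oplus> (r \<oplus> p) \<ominus> (q \<oplus> s)"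
    using assms by (simp add: a_minus_def minus_add a_ac)
  with assms show ?thesis
    by (auto simp: minus_eq_zero_iff)
qed

end

section \<open>Modules and cochains\<close>

lemma (in abelian_group) cochains_group: "group (cochains S G)"
proof (rule groupI)
  fix c assume c: "c \<in> carrier (cochains S G)"
  have "(\<lambda>s\<in>S. \<ominus> c s) \<in> carrier (cochains S G)"
    "(\<lambda>s\<in>S. \<ominus> c s) \<otimes>\<^bsub>cochains S G\<^esub> c = \<one>\<^bsub>cochains S G\<^esub>"
    using c by (auto simp: cochains_def PiE_iff l_neg cong: restrict_cong)
  then show "\<exists>d\<in>carrier (cochains S G). d \<otimes>\<^bsub>cochains S G\<^esub> c = \<one>\<^bsub>cochains S G\<^esub>"
    by blast
qed (auto simp: cochains_def PiE_iff a_assoc extensional_def fun_eq_iff)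

context group_module
begin

lemma act_zero: "x \<in> carrier G \<Longrightarrow> act x \<zero>\<^bsub>A\<^esub> = \<zero>\<^bsub>A\<^esub>"
  using act_add[of x "\<zero>\<^bsub>A\<^esub>" "\<zero>\<^bsub>A\<^esub>"] act_closed[of x "\<zero>\<^bsub>A\<^esub>"] by simp

lemma act_minus:
  assumes "x \<in> carrier G" "a \<in> carrier A"
  shows "act x (\<ominus>\<^bsub>A\<^esub> a) = \<ominus>\<^bsub>A\<^esub> act x a"
  using assms act_add[of x "\<ominus>\<^bsub>A\<^esub> a" a]
  by (simp add: A.l_neg act_zero act_closed A.minus_equality)

lemma restrict_scalars:
  assumes "group H" "\<phi> \<in> hom H G"
  shows "group_module H A (\<lambda>x. act (\<phi> x))"
proof -
  interpret H: group H by fact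
  interpret \<phi>: group_hom H G \<phi> using assms(2) by unfold_locales
  show ?thesis
    by unfold_locales (auto simp: act_closed act_add act_one act_mult)
qed

lemma coboundary2_in_cochains3:
  assumes "c \<in> carrier (cochains2 G A)"
  shows "coboundary2 G A act c \<in> carrier (cochains3 G A)"
  using assms
  by (auto simp: cochains_def coboundary2_def PiE_iff act_closed)

lemma coboundary2_hom: "coboundary2 G A act \<in> hom (cochains2 G A) (cochains3 G A)"
proof (rule homI)
  fix c d
  assume c: "c \<in> carrier (cochains2 G A)" and d: "d \<in> carrier (cochains2 G A)"
  show "coboundary2 G A act (c \<otimes>\<^bsub>cochains2 G A\<^esub> d)
      = coboundary2 G A act c \<otimes>\<^bsub>cochains3 G A\<^esub> coboundary2 G A act d"
    using c d
    by (auto simp: cochains_def coboundary2_def fun_eq_iff PiE_iff act_closed act_add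
        a_minus_def A.minus_add A.a_ac)
qed (rule coboundary2_in_cochains3)

lemma B3_subgroup: "subgroup (B3 G A act) (cochains3 G A)"
proof -
  interpret \<delta>: group_hom "cochains2 G A" "cochains3 G A" "coboundary2 G A act"
    by (simp add: group_hom_def group_hom_axioms_def A.cochains_group coboundary2_hom)
  show ?thesis
    unfolding B3_def by (rule \<delta>.img_is_subgroup)
qed

text \<open>The class is the coset of \<open>k\<close> modulo the coboundaries. Since the coset is formed with
  pointwise addition, the question can be settled in the group of all 3-cochains,
  of which the coboundaries are a subgroup.\<close>

lemma H3_class_eq_one_iff:
  assumes "k \<in> carrier (cochains3 G A)"
  shows "H3_class G A act k = \<one>\<^bsub>H3 G A act\<^esub> \<longleftrightarrow> k \<in> B3 G A act"
proof -
  interpret C3: group "cochains3 G A" by (rule A.cochains_group)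
  have "H3_class G A act k = B3 G A act #>\<^bsub>cochains3 G A\<^esub> k"
    by (simp add: H3_class_def r_coset_def Z3_def)
  moreover have "\<one>\<^bsub>H3 G A act\<^esub> = B3 G A act"
    by (simp add: H3_def FactGroup_def)
  ultimately show ?thesis
    using C3.coset_join1[OF _ assms B3_subgroup]
      C3.coset_join2[OF assms B3_subgroup]
    by auto
qed

end

section \<open>The Gr-category of a cocycle\<close>

lemma cocycle_cat_simps [simp]:
  "Obj (cocycle_cat G A act \<xi>) = carrier G"
  "Arr (cocycle_cat G A act \<xi>) = carrier G \<times> carrier A"
  "Dom (cocycle_cat G A act \<xi>) = fst"
  "Cod (cocycle_cat G A act \<xi>) = fst"
  "Id (cocycle_cat G A act \<xi>) x = (x, \<zero>\<^bsub>A\<^esub>)"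
  "(x, u) \<cdot>\<^bsub>cocycle_cat G A act \<xi>\<^esub> (y, v) = (x, u \<oplus>\<^bsub>A\<^esub> v)"
  "x \<boxdot>\<^bsub>cocycle_cat G A act \<xi>\<^esub> y = x \<otimes>\<^bsub>G\<^esub> y"
  "(x, u) \<boxtimes>\<^bsub>cocycle_cat G A act \<xi>\<^esub> (y, v) = (x \<otimes>\<^bsub>G\<^esub> y, u \<oplus>\<^bsub>A\<^esub> act x v)"
  "Unit (cocycle_cat G A act \<xi>) = \<one>\<^bsub>G\<^esub>"
  "Assoc (cocycle_cat G A act \<xi>) x y z = (x \<otimes>\<^bsub>G\<^esub> y \<otimes>\<^bsub>G\<^esub> z, \<xi> (x, y, z))"
  "LUnit (cocycle_cat G A act \<xi>) x = (x, \<zero>\<^bsub>A\<^esub>)"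
  "RUnit (cocycle_cat G A act \<xi>) x = (x, \<zero>\<^bsub>A\<^esub>)"
  by (simp_all add: cocycle_cat_def)

lemma Hom_cocycle_cat:
  "h \<in> Hom (cocycle_cat G A act \<xi>) x y \<longleftrightarrow>
    x \<in> carrier G \<and> y = x \<and> (\<exists>u \<in> carrier A. h = (x, u))"
  by (auto simp: Hom_def)

context group_module
begin

lemma iso_arrows_cocycle_cat:
  "iso_arrows (cocycle_cat G A act \<xi>) x y = Hom (cocycle_cat G A act \<xi>) x y"
proof -
  have "\<exists>g \<in> Hom (cocycle_cat G A act \<xi>) y x.
      g \<cdot>\<^bsub>cocycle_cat G A act \<xi>\<^esub> h = Id (cocycle_cat G A act \<xi>) x \<and>
      h \<cdot>\<^bsub>cocycle_cat G A act \<xi>\<^esub> g = Id (cocycle_cat G A act \<xi>) y"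
    if h: "h \<in> Hom (cocycle_cat G A act \<xi>) x y" for h
  proof -
    from h obtain u where "x \<in> carrier G" "y = x" "u \<in> carrier A" "h = (x, u)"
      by (auto simp: Hom_cocycle_cat)
    then show ?thesis
      by (intro bexI[of _ "(x, \<ominus>\<^bsub>A\<^esub> u)"]) (auto simp: Hom_cocycle_cat A.l_neg A.r_neg)
  qed
  then show ?thesis by (auto simp: iso_arrows_def)
qed

lemma cocycle_closed:
  assumes "\<xi> \<in> carrier (Z3 G A act)" "x \<in> carrier G" "y \<in> carrier G" "z \<in> carrier G"
  shows "\<xi> (x, y, z) \<in> carrier A"
  using assms by (auto simp: Z3_def kernel_def cochains_def)

text \<open>The cocycle condition in the form in which it is the pentagon axiom.\<close>

lemma cocycle_identity:
  assumes \<xi>: "\<xi> \<in> carrier (Z3 G A act)"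
    and G: "x \<in> carrier G" "y \<in> carrier G" "z \<in> carrier G" "t \<in> carrier G"
  shows "\<xi> (x \<otimes>\<^bsub>G\<^esub> y, z, t) \<oplus>\<^bsub>A\<^esub> \<xi> (x, y, z \<otimes>\<^bsub>G\<^esub> t)
    = \<xi> (x, y, z) \<oplus>\<^bsub>A\<^esub> (\<xi> (x, y \<otimes>\<^bsub>G\<^esub> z, t) \<oplus>\<^bsub>A\<^esub> act x (\<xi> (y, z, t)))"
proof -
  have "coboundary3 G A act \<xi> = \<one>\<^bsub>cochains4 G A\<^esub>"
    using \<xi> by (simp add: Z3_def kernel_def)
  from fun_cong[OF this, of "(x, y, z, t)"] G show ?thesis
    by (simp add: coboundary3_def cochains_def A.alternating_sum_zero_iff
        cocycle_closed[OF \<xi>] act_closed)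
qed

text \<open>The cocycle condition gives the pentagon, and normalization gives the triangle, whose unit
  constraints are identities and which therefore needs \<open>\<xi>(x,1,y) = 0\<close>. Naturality of the
  associativity constraint holds since \<open>A\<close> is commutative and the action is associative. An
  object is invertible because its group inverse is, strictly, a tensor inverse.\<close>

lemma gr_category_cocycle_cat:
  assumes \<xi>: "\<xi> \<in> carrier (Z3 G A act)" and norm: "normalized3 G A \<xi>"
  shows "gr_category (cocycle_cat G A act \<xi>)"
proof
  fix x assume "x \<in> Obj (cocycle_cat G A act \<xi>)"
  then show "\<exists>y \<in> Obj (cocycle_cat G A act \<xi>).
      iso_arrows (cocycle_cat G A act \<xi>) (x \<boxdot>\<^bsub>cocycle_cat G A act \<xi>\<^esub> y)
        (Unit (cocycle_cat G A act \<xi>)) \<noteq> {} \<and>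
      iso_arrows (cocycle_cat G A act \<xi>) (y \<boxdot>\<^bsub>cocycle_cat G A act \<xi>\<^esub> x)
        (Unit (cocycle_cat G A act \<xi>)) \<noteq> {}"
    by (intro bexI[of _ "inv\<^bsub>G\<^esub> x"])
      (auto simp: iso_arrows_cocycle_cat Hom_cocycle_cat simp flip: ex_in_conv)
next
  fix x y z t
  assume "x \<in> Obj (cocycle_cat G A act \<xi>)" "y \<in> Obj (cocycle_cat G A act \<xi>)"
    "z \<in> Obj (cocycle_cat G A act \<xi>)" "t \<in> Obj (cocycle_cat G A act \<xi>)"
  then show "Assoc (cocycle_cat G A act \<xi>) (x \<boxdot>\<^bsub>cocycle_cat G A act \<xi>\<^esub> y) z t
        \<cdot>\<^bsub>cocycle_cat G A act \<xi>\<^esub>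
        Assoc (cocycle_cat G A act \<xi>) x y (z \<boxdot>\<^bsub>cocycle_cat G A act \<xi>\<^esub> t)
      = (Assoc (cocycle_cat G A act \<xi>) x y z
          \<boxtimes>\<^bsub>cocycle_cat G A act \<xi>\<^esub> Id (cocycle_cat G A act \<xi>) t)
        \<cdot>\<^bsub>cocycle_cat G A act \<xi>\<^esub>
        (Assoc (cocycle_cat G A act \<xi>) x (y \<boxdot>\<^bsub>cocycle_cat G A act \<xi>\<^esub> z) t
          \<cdot>\<^bsub>cocycle_cat G A act \<xi>\<^esub>
          (Id (cocycle_cat G A act \<xi>) x
            \<boxtimes>\<^bsub>cocycle_cat G A act \<xi>\<^esub> Assoc (cocycle_cat G A act \<xi>) y z t))"
    using cocycle_identity[OF \<xi>, of x y z t]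
    by (simp add: cocycle_closed[OF \<xi>] act_closed act_zero G.m_assoc)
qed (auto simp: iso_arrows_cocycle_cat Hom_cocycle_cat act_closed act_add act_one act_mult
    act_zero cocycle_closed[OF \<xi>] G.m_assoc A.a_ac
    norm[unfolded normalized3_def])

end

section \<open>Monoidal structures and the obstruction\<close>

text \<open>The arrow parts of \<open>Ft\<close> form a 2-cochain \<open>c\<close>, and the associativity coherence says
  precisely that the obstruction is the coboundary of \<open>c\<close>. The unit coherences impose no further
  condition on the obstruction, because normalization forces
  \<open>c(1,x) = c(1,1)\<close> and \<open>c(x,1) = x c(1,1)\<close>, and the choice of \<open>- c(1,1)\<close> for \<open>Fh\<close> cancels both.\<close>

lemma monoidal_structure_iff_obstruction_coboundary:
  fixes G :: "('g, 'k) monoid_scheme" and A :: "('a, 'l) ring_scheme"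
    and G' :: "('h, 'i) monoid_scheme" and A' :: "('b, 'j) ring_scheme"
  assumes "group_module G A act" and "group_module G' A' act'"
    and \<xi>: "\<xi> \<in> carrier (Z3 G A act)" and norm: "normalized3 G A \<xi>"
    and \<xi>': "\<xi>' \<in> carrier (Z3 G' A' act')" and norm': "normalized3 G' A' \<xi>'"
    and F: "functor_of_type G A act \<xi> G' A' act' \<xi>' \<phi> f F"
  shows "(\<exists>Ft Fh. monoidal_functor (cocycle_cat G A act \<xi>) (cocycle_cat G' A' act' \<xi>') F Ft Fh)
    \<longleftrightarrow> obstruction G A' \<phi> f \<xi> \<xi>' \<in> B3 G A' (\<lambda>x. act' (\<phi> x))"
    (is "(\<exists>Ft Fh. monoidal_functor ?C ?D F Ft Fh) \<longleftrightarrow> ?k \<in> B3 G A' ?act")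
proof -
  interpret M: group_module G A act by fact
  interpret M': group_module G' A' act' by fact
  have F_functor: "cat_functor ?C ?D F" and \<phi>: "\<phi> \<in> hom G G'"
    and f: "f \<in> hom (add_monoid A) (add_monoid A')"
    and f_act: "\<And>x a. \<lbrakk>x \<in> carrier G; a \<in> carrier A\<rbrakk> \<Longrightarrow> f (act x a) = act' (\<phi> x) (f a)"
    and F_obj: "\<And>x. x \<in> carrier G \<Longrightarrow> obj_map F x = \<phi> x"
    and F_arr: "\<And>x u. \<lbrakk>x \<in> carrier G; u \<in> carrier A\<rbrakk> \<Longrightarrow> arr_map F (x, u) = (\<phi> x, f u)"
    using F by (auto simp: functor_of_type_def)
  interpret \<phi>: group_hom G G' \<phi> using \<phi> by unfold_locales
  interpret f: group_hom "add_monoid A" "add_monoid A'" f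
    using f by (simp add: group_hom_def group_hom_axioms_def M.A.a_group M'.A.a_group)
  have f_closed: "\<And>a. a \<in> carrier A \<Longrightarrow> f a \<in> carrier A'"
    and f_add: "\<And>a b. \<lbrakk>a \<in> carrier A; b \<in> carrier A\<rbrakk> \<Longrightarrow> f (a \<oplus>\<^bsub>A\<^esub> b) = f a \<oplus>\<^bsub>A'\<^esub> f b"
    and f_zero: "f \<zero>\<^bsub>A\<^esub> = \<zero>\<^bsub>A'\<^esub>"
    using f.hom_closed f.hom_mult f.hom_one by auto
  interpret C: gr_category ?C by (rule M.gr_category_cocycle_cat) fact+
  interpret D: gr_category ?D by (rule M'.gr_category_cocycle_cat) fact+
  interpret F: cat_functor ?C ?D F by fact
  note closed = M.cocycle_closed[OF \<xi>] M'.cocycle_closed[OF \<xi>'] f_closed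
  note iso = M'.iso_arrows_cocycle_cat Hom_cocycle_cat
  have k_apply: "?k (x, y, z) = \<xi>' (\<phi> x, \<phi> y, \<phi> z) \<ominus>\<^bsub>A'\<^esub> f (\<xi> (x, y, z))"
    if "x \<in> carrier G" "y \<in> carrier G" "z \<in> carrier G" for x y z
    using that by (simp add: obstruction_def pull_cochain_def push_cochain_def)
  have coherence_iff: "f (\<xi> (x, y, z)) \<oplus>\<^bsub>A'\<^esub> (c (x, y \<otimes>\<^bsub>G\<^esub> z) \<oplus>\<^bsub>A'\<^esub> act' (\<phi> x) (c (y, z)))
        = c (x \<otimes>\<^bsub>G\<^esub> y, z) \<oplus>\<^bsub>A'\<^esub> (c (x, y) \<oplus>\<^bsub>A'\<^esub> \<xi>' (\<phi> x, \<phi> y, \<phi> z))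
      \<longleftrightarrow> ?k (x, y, z) = coboundary2 G A' ?act c (x, y, z)"
    if "c \<in> carrier (cochains2 G A')" "x \<in> carrier G" "y \<in> carrier G" "z \<in> carrier G"
    for c x y z
    using that
    by (subst M'.A.four_term_eq_iff)
      (auto simp: k_apply coboundary2_def cochains_def closed PiE_iff M'.act_closed)
  show ?thesis
  proof
    assume "\<exists>Ft Fh. monoidal_functor ?C ?D F Ft Fh"
    then obtain Ft Fh where "monoidal_functor ?C ?D F Ft Fh" by blast
    then interpret F: monoidal_functor ?C ?D F Ft Fh .
    \<comment> \<open>Restricted to the carrier, since cochains are extensional while \<open>Ft\<close> is
      arbitrary outside it.\<close>
    define c where "c = (\<lambda>(x, y) \<in> carrier G \<times> carrier G. snd (Ft x y))"
    have Ft: "Ft x y = (\<phi> x \<otimes>\<^bsub>G'\<^esub> \<phi> y, c (x, y))" and c_closed: "c (x, y) \<in> carrier A'"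
      if "x \<in> carrier G" "y \<in> carrier G" for x y
      using F.Ft_iso[of x y] that by (auto simp: iso F_obj c_def)
    have c: "c \<in> carrier (cochains2 G A')"
      using c_closed by (auto simp: cochains_def c_def)
    have "?k (x, y, z) = coboundary2 G A' ?act c (x, y, z)"
      if G: "x \<in> carrier G" "y \<in> carrier G" "z \<in> carrier G" for x y z
      using F.assoc_coherence[of x y z] G
      by (simp add: F_obj F_arr Ft closed c_closed M'.act_closed M'.act_zero
          coherence_iff[OF c G, symmetric])
    then have "?k = coboundary2 G A' ?act c"
      by (auto simp: fun_eq_iff obstruction_def coboundary2_def)
    with c show "?k \<in> B3 G A' ?act" by (auto simp: B3_def)
  next
    assume "?k \<in> B3 G A' ?act"
    then obtain c where c: "c \<in> carrier (cochains2 G A')" and k: "?k = coboundary2 G A' ?act c"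
      by (auto simp: B3_def)
    have c_closed: "c (x, y) \<in> carrier A'" if "x \<in> carrier G" "y \<in> carrier G" for x y
      using c that by (auto simp: cochains_def)
    have \<xi>_one: "\<xi> (\<one>\<^bsub>G\<^esub>, x, y) = \<zero>\<^bsub>A\<^esub>" "\<xi> (x, y, \<one>\<^bsub>G\<^esub>) = \<zero>\<^bsub>A\<^esub>"
      if "x \<in> carrier G" "y \<in> carrier G" for x y
      using norm that by (auto simp: normalized3_def)
    have \<xi>'_one: "\<xi>' (\<one>\<^bsub>G'\<^esub>, x, y) = \<zero>\<^bsub>A'\<^esub>" "\<xi>' (x, y, \<one>\<^bsub>G'\<^esub>) = \<zero>\<^bsub>A'\<^esub>"
      if "x \<in> carrier G'" "y \<in> carrier G'" for x y
      using norm' that by (auto simp: normalized3_def)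
    \<comment> \<open>Named so that \<open>c(1,x) = c(1,1)\<close> can be used as a rewrite rule without applying to its
      own right-hand side.\<close>
    define c\<^sub>1 where "c\<^sub>1 = c (\<one>\<^bsub>G\<^esub>, \<one>\<^bsub>G\<^esub>)"
    have c\<^sub>1_closed: "c\<^sub>1 \<in> carrier A'"
      by (simp add: c\<^sub>1_def c_closed)
    \<comment> \<open>At \<open>(1,1,x)\<close> and \<open>(x,1,1)\<close> both \<open>\<xi>\<close> and \<open>\<xi>'\<close> vanish, and the coherence equation
      expresses \<open>c(1,x)\<close> and \<open>c(x,1)\<close> through \<open>c(1,1)\<close>.\<close>
    have c_left: "c (\<one>\<^bsub>G\<^esub>, x) = c\<^sub>1" if x: "x \<in> carrier G" for x
      using coherence_iff[OF c M.G.one_closed M.G.one_closed x] x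
      by (simp add: k \<xi>_one \<xi>'_one f_zero c_closed M'.act_one c\<^sub>1_def)
    have c_right: "c (x, \<one>\<^bsub>G\<^esub>) = act' (\<phi> x) c\<^sub>1" if x: "x \<in> carrier G" for x
      using coherence_iff[OF c x M.G.one_closed M.G.one_closed] x
      by (simp add: k \<xi>_one \<xi>'_one f_zero c_closed M'.act_closed c\<^sub>1_def)
    define Ft where "Ft = (\<lambda>x y. (\<phi> (x \<otimes>\<^bsub>G\<^esub> y), c (x, y)))"
    define Fh where "Fh = (\<one>\<^bsub>G'\<^esub>, \<ominus>\<^bsub>A'\<^esub> c\<^sub>1)"
    have "monoidal_functor ?C ?D F Ft Fh"
    proof
      fix x y z
      assume "x \<in> Obj ?C" "y \<in> Obj ?C" "z \<in> Obj ?C"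
      then show "arr_map F (Assoc ?C x y z)
          \<cdot>\<^bsub>?D\<^esub> (Ft x (y \<boxdot>\<^bsub>?C\<^esub> z) \<cdot>\<^bsub>?D\<^esub> (Id ?D (obj_map F x) \<boxtimes>\<^bsub>?D\<^esub> Ft y z))
        = Ft (x \<boxdot>\<^bsub>?C\<^esub> y) z
          \<cdot>\<^bsub>?D\<^esub> ((Ft x y \<boxtimes>\<^bsub>?D\<^esub> Id ?D (obj_map F z))
          \<cdot>\<^bsub>?D\<^esub> Assoc ?D (obj_map F x) (obj_map F y) (obj_map F z))"
        using coherence_iff[OF c, of x y z]
        by (simp add: k F_obj F_arr Ft_def closed c_closed M'.act_closed M'.act_zero)
    qed (auto simp: iso Ft_def Fh_def F_obj F_arr c_closed c\<^sub>1_closed closed c_left c_right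
        f_add f_act f_zero M.act_closed M'.act_closed M'.act_minus M'.act_one M'.A.r_neg
        M'.A.a_ac)
    then show "\<exists>Ft Fh. monoidal_functor ?C ?D F Ft Fh" by blast
  qed
qed

theorem theorem6:
  fixes G :: "('g, 'k) monoid_scheme" and A :: "('a, 'l) ring_scheme"
    and G' :: "('h, 'i) monoid_scheme" and A' :: "('b, 'j) ring_scheme"
    and act :: "'g \<Rightarrow> 'a \<Rightarrow> 'a" and act' :: "'h \<Rightarrow> 'b \<Rightarrow> 'b"
    and \<xi> :: "'g \<times> 'g \<times> 'g \<Rightarrow> 'a" and \<xi>' :: "'h \<times> 'h \<times> 'h \<Rightarrow> 'b"
    and \<phi> :: "'g \<Rightarrow> 'h" and f :: "'a \<Rightarrow> 'b"
    and F :: "('g, 'g \<times> 'a, 'h, 'h \<times> 'b) cat_map"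
  assumes "group_module G A act"
    and "\<xi> \<in> carrier (Z3 G A act)" and "normalized3 G A \<xi>"
    and "group_module G' A' act'"
    and "\<xi>' \<in> carrier (Z3 G' A' act')" and "normalized3 G' A' \<xi>'"
    and "functor_of_type G A act \<xi> G' A' act' \<xi>' \<phi> f F"
  shows "gr_functor (cocycle_cat G A act \<xi>) (cocycle_cat G' A' act' \<xi>') F \<longleftrightarrow>
    H3_class G A' (\<lambda>x. act' (\<phi> x)) (obstruction G A' \<phi> f \<xi> \<xi>')
      = \<one>\<^bsub>H3 G A' (\<lambda>x. act' (\<phi> x))\<^esub>"
proof -
  interpret M: group_module G A act by fact
  interpret M': group_module G' A' act' by fact
  have \<phi>: "\<phi> \<in> hom G G'" and f: "f \<in> hom (add_monoid A) (add_monoid A')"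
    using assms(7) by (auto simp: functor_of_type_def)
  interpret M'': group_module G A' "\<lambda>x. act' (\<phi> x)"
    using M'.restrict_scalars M.G.is_group \<phi> by blast
  have "\<phi> x \<in> carrier G'" if "x \<in> carrier G" for x
    using \<phi> that by (rule hom_in_carrier)
  moreover have "f a \<in> carrier A'" if "a \<in> carrier A" for a
    using hom_in_carrier[OF f, of a] that by simp
  ultimately have "obstruction G A' \<phi> f \<xi> \<xi>' \<in> carrier (cochains3 G A')"
    using M.cocycle_closed[OF assms(2)] M'.cocycle_closed[OF assms(5)]
    by (auto simp: cochains_def obstruction_def pull_cochain_def push_cochain_def)
  then show ?thesis
    using M.gr_category_cocycle_cat[OF assms(2,3)] M'.gr_category_cocycle_cat[OF assms(5,6)]
      monoidal_structure_iff_obstruction_coboundary[OF assms(1,4,2,3,5,6,7)]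
    by (simp add: gr_functor_def M''.H3_class_eq_one_iff)
qed

end
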